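(* Let $G'$ be a set of polynomials over a (commutative) polynomial ring, with coefficients in a field $R$, containing variables $x_1,\dots,x_n$ and a homogenising variable $y$. If (i) $G'$ is an Involutive Basis with respect to some extendible monomial ordering $O$ and some involutive division $I$ that is extendible with respect to $O$; and (ii) $d(G')=\{d(g') : g'\in G'\}$ is an autoreduced set, then $d(G')$ is an Involutive Basis with respect to $O$ and $I$.
   Context: All rings are commutative polynomial rings. Monomial orderings used for Involutive Bases are admissible: $1<m$ for all monomials $m\ne1$, and $m_1<m_2$ implies $m_1m<m_2m$. $\mathrm{LM},\mathrm{LC}$ denote leading monomial and leading coefficient. Homogenisation: for $p=p_0+\cdots+p_m$ in $x_1,\dots,x_n$, with $p_i$ the sum of the degree-$i$ terms and $p_m\neq0$, $h(p)=p_0y^m+p_1y^{m-1}+\cdots+p_{m-1}y+p_m$, a polynomial in a ring determined by where the new variable $y$ is placed in the lexicographical ordering of the variables. Dehomogenisation: $d(p)$ is the polynomial obtained from a polynomial $p$ by substituting $y=1$. A monomial ordering $O$ is extendible if, given any polynomial $p=t_1+\cdots+t_\alpha$ with terms $t_1>\cdots>t_\alpha$ with respect to $O$, the homogenisation of $p$ preserves the order on the terms: $t_i'>t_{i+1}'$ for all $1\le i\le\alpha-1$, where $t_i'$ is the term of $h(p)$ to which $t_i$ is mapped. An involutive division $I$ assigns to each element $u$ of any finite set $U$ of monomials a set $\mathcal M_I(u,U)$ of multiplicative variables. Write $u\mid_I w$ (with respect to $U$) if $w=uv$ for a monomial $v$ all of whose variables lie in $\mathcal M_I(u,U)$, and $\mathcal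 C_I(u,U)=\{w:u\mid_I w\}$. It is required that: if $\mathcal C_I(u_1,U)\cap\mathcal C_I(u_2,U)\neq\emptyset$ for $u_1,u_2\in U$, then one of these two cones is contained in the other; and if $V\subset U$ then $\mathcal M_I(v,U)\subseteq\mathcal M_I(v,V)$ for all $v\in V$. For a set $P$ of polynomials, multiplicative variables are those of the leading monomials: $\mathcal M_I(p,P)=\mathcal M_I(\mathrm{LM}(p),\mathrm{LM}(P))$. For a fixed extendible monomial ordering $O$, an involutive division $I$ is extendible with respect to $O$ if, given any set of polynomials $P$, one has $\mathcal M_I(p,P)\setminus\{y\}=\mathcal M_I(d(p),d(P))$ for all $p\in P$, where $y$ is the homogenising variable. Involutive reduction of $f$ by $P$: repeatedly take the leading term $c\,w$ of the current polynomial; if $\mathrm{LM}(p)\mid_I w$ (with respect to $\mathrm{LM}(P)$) for some $p\in P$, subtract $c\,\mathrm{LC}(p)^{-1}p\,(w/\mathrm{LM}(p))$, otherwise move $c\,w$ to the remainder; $f$ involutively reduces to zero if the final remainder is $0$. $P$ is autoreduced if no $p\in P$ contains a term which is involutively divisible (with respect to $P$) by some $p'\in P\setminus\{p\}$. An autoreduced set $P$ is an Involutive Basis with respect to $I$ and $O$ if any multiple $pt$ of any $p\in P$ by any term $t$ involutively reduces to zero using $P$. *)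

theory Defs
  imports "HOL-Library.Poly_Mapping"
begin

(* A monomial is its exponent vector, so the product of monomials is + and the monomial 1 is 0.
   Variables are elements of an arbitrary type; the polynomial ring over a finite set V of
   variables is the carrier polys V. *)

type_synonym 'v mono = "'v \<Rightarrow>\<^sub>0 nat"
type_synonym ('v, 'a) mpoly = "'v mono \<Rightarrow>\<^sub>0 'a"

definition monomials :: "'v set \<Rightarrow> 'v mono set" where
  "monomials V = {m. Poly_Mapping.keys m \<subseteq> V}"

definition polys :: "'v set \<Rightarrow> ('v, 'a::zero) mpoly set" where
  "polys V = {p. Poly_Mapping.keys p \<subseteq> monomials V}"

definition mono_degree :: "'v mono \<Rightarrow> nat" where
  "mono_degree m = (\<Sum>v\<in>Poly_Mapping.keys m. Poly_Mapping.lookup m v)"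

definition poly_degree :: "('v, 'a::zero) mpoly \<Rightarrow> nat" where
  "poly_degree p = Max (mono_degree ` Poly_Mapping.keys p)"

definition homogeneous_polys :: "'v set \<Rightarrow> ('v, 'a::zero) mpoly set" where
  "homogeneous_polys V = {p \<in> polys V. \<exists>d. \<forall>m\<in>Poly_Mapping.keys p. mono_degree m = d}"

definition admissible_order :: "'v set \<Rightarrow> ('v mono \<Rightarrow> 'v mono \<Rightarrow> bool) \<Rightarrow> bool" where
  "admissible_order V lt \<longleftrightarrow>
     irreflp_on (monomials V) lt \<and> transp_on (monomials V) lt \<and> totalp_on (monomials V) lt \<and>
     (\<forall>m\<in>monomials V. m \<noteq> 0 \<longrightarrow> lt 0 m) \<and>
     (\<forall>m1\<in>monomials V. \<forall>m2\<in>monomials V. \<forall>m\<in>monomials V. lt m1 m2 \<longrightarrow> lt (m1 + m) (m2 + m))"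

definition LM :: "('v mono \<Rightarrow> 'v mono \<Rightarrow> bool) \<Rightarrow> ('v, 'a::zero) mpoly \<Rightarrow> 'v mono" where
  "LM lt p = (THE m. m \<in> Poly_Mapping.keys p \<and>
     (\<forall>m'\<in>Poly_Mapping.keys p. m' \<noteq> m \<longrightarrow> lt m' m))"

definition LC :: "('v mono \<Rightarrow> 'v mono \<Rightarrow> bool) \<Rightarrow> ('v, 'a::zero) mpoly \<Rightarrow> 'a" where
  "LC lt p = Poly_Mapping.lookup p (LM lt p)"

(* h(p) is obtained from p by replacing every monomial m by homogenise_mono y (poly_degree p) m. *)
definition homogenise_mono :: "'v \<Rightarrow> nat \<Rightarrow> 'v mono \<Rightarrow> 'v mono" where
  "homogenise_mono y d m = m + Poly_Mapping.single y (d - mono_degree m)"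

definition dehomogenise :: "'v \<Rightarrow> ('v, 'a::comm_monoid_add) mpoly \<Rightarrow> ('v, 'a) mpoly" where
  "dehomogenise y p = (\<Sum>m\<in>Poly_Mapping.keys p.
     Poly_Mapping.single (Poly_Mapping.update y 0 m) (Poly_Mapping.lookup p m))"

(* One relation orders the monomials in the variables of X and y; its restriction to
   monomials X is the ordering used before homogenisation. The first argument only carries the coefficient type. *)
definition extendible_order ::
  "'a::zero itself \<Rightarrow> 'v set \<Rightarrow> 'v \<Rightarrow> ('v mono \<Rightarrow> 'v mono \<Rightarrow> bool) \<Rightarrow> bool" where
  "extendible_order _ X y lt \<longleftrightarrow>
     (\<forall>p \<in> (polys X :: ('v, 'a) mpoly set).
        \<forall>m1\<in>Poly_Mapping.keys p. \<forall>m2\<in>Poly_Mapping.keys p. lt m2 m1 \<longrightarrow>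
          lt (homogenise_mono y (poly_degree p) m2) (homogenise_mono y (poly_degree p) m1))"

definition inv_cone :: "('v mono \<Rightarrow> 'v mono set \<Rightarrow> 'v set) \<Rightarrow> 'v mono \<Rightarrow> 'v mono set \<Rightarrow> 'v mono set" where
  "inv_cone M u U = {u + v |v. v \<in> monomials (M u U)}"

definition involutive_division :: "'v set \<Rightarrow> ('v mono \<Rightarrow> 'v mono set \<Rightarrow> 'v set) \<Rightarrow> bool" where
  "involutive_division V M \<longleftrightarrow>
     (\<forall>U. finite U \<and> U \<subseteq> monomials V \<longrightarrow>
        (\<forall>u\<in>U. M u U \<subseteq> V) \<and>
        (\<forall>u1\<in>U. \<forall>u2\<in>U. inv_cone M u1 U \<inter> inv_cone M u2 U \<noteq> {} \<longrightarrow>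
           inv_cone M u1 U \<subseteq> inv_cone M u2 U \<or> inv_cone M u2 U \<subseteq> inv_cone M u1 U) \<and>
        (\<forall>W\<subseteq>U. \<forall>w\<in>W. M w U \<subseteq> M w W))"

definition mult_vars :: "('v mono \<Rightarrow> 'v mono set \<Rightarrow> 'v set) \<Rightarrow> ('v mono \<Rightarrow> 'v mono \<Rightarrow> bool) \<Rightarrow>
    ('v, 'a::zero) mpoly \<Rightarrow> ('v, 'a) mpoly set \<Rightarrow> 'v set" where
  "mult_vars M lt p P = M (LM lt p) (LM lt ` P)"

(* A division such as Janet's is a rule for every polynomial ring: I V u U are the multiplicative
   variables of u in U when the ring has the variables V. The polynomials d(p) live in the ring
   without y. "Any set of polynomials" is any finite P in a class K: all polynomials of the ring (the
   literal reading, a very strong demand since LM(d(p)) is then unrelated to LM(p)) or the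
   homogeneous ones (the situation after homogenisation). Sets P with 0 in d(P), where LM(d(p))
   does not exist, are left out. *)
definition extendible_division ::
  "('v, 'a::comm_monoid_add) mpoly set \<Rightarrow> 'v set \<Rightarrow> 'v \<Rightarrow> ('v mono \<Rightarrow> 'v mono \<Rightarrow> bool) \<Rightarrow>
     ('v set \<Rightarrow> 'v mono \<Rightarrow> 'v mono set \<Rightarrow> 'v set) \<Rightarrow> bool" where
  "extendible_division K X y lt I \<longleftrightarrow>
     (\<forall>P. finite P \<and> P \<subseteq> K \<and> 0 \<notin> dehomogenise y ` P \<longrightarrow>
        (\<forall>p\<in>P. mult_vars (I (insert y X)) lt p P - {y} =
                mult_vars (I X) lt (dehomogenise y p) (dehomogenise y ` P)))"

(* State: (current polynomial, remainder collected so far). *)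
inductive inv_red_step :: "('v mono \<Rightarrow> 'v mono set \<Rightarrow> 'v set) \<Rightarrow> ('v mono \<Rightarrow> 'v mono \<Rightarrow> bool) \<Rightarrow>
    ('v, 'a::field) mpoly set \<Rightarrow> ('v, 'a) mpoly \<times> ('v, 'a) mpoly \<Rightarrow>
    ('v, 'a) mpoly \<times> ('v, 'a) mpoly \<Rightarrow> bool"
  for M lt P where
  reduce: "\<lbrakk>f \<noteq> 0; p \<in> P; LM lt f \<in> inv_cone M (LM lt p) (LM lt ` P)\<rbrakk> \<Longrightarrow>
     inv_red_step M lt P (f, r)
       (f - Poly_Mapping.single (LM lt f - LM lt p) (LC lt f * inverse (LC lt p)) * p, r)"
| remainder: "\<lbrakk>f \<noteq> 0; \<forall>p\<in>P. LM lt f \<notin> inv_cone M (LM lt p) (LM lt ` P)\<rbrakk> \<Longrightarrow>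
     inv_red_step M lt P (f, r)
       (f - Poly_Mapping.single (LM lt f) (LC lt f),
        r + Poly_Mapping.single (LM lt f) (LC lt f))"

definition inv_reduces_to_zero :: "('v mono \<Rightarrow> 'v mono set \<Rightarrow> 'v set) \<Rightarrow>
    ('v mono \<Rightarrow> 'v mono \<Rightarrow> bool) \<Rightarrow> ('v, 'a::field) mpoly set \<Rightarrow> ('v, 'a) mpoly \<Rightarrow> bool" where
  "inv_reduces_to_zero M lt P f \<longleftrightarrow> (inv_red_step M lt P)\<^sup>*\<^sup>* (f, 0) (0, 0)"

(* P has to be finite and without 0 for involutive divisibility with respect to P to make sense. *)
definition autoreduced :: "'v set \<Rightarrow> ('v mono \<Rightarrow> 'v mono \<Rightarrow> bool) \<Rightarrow>
    ('v mono \<Rightarrow> 'v mono set \<Rightarrow> 'v set) \<Rightarrow> ('v, 'a::zero) mpoly set \<Rightarrow> bool" where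
  "autoreduced V lt M P \<longleftrightarrow>
     finite P \<and> P \<subseteq> polys V \<and> 0 \<notin> P \<and>
     (\<forall>p\<in>P. \<forall>m\<in>Poly_Mapping.keys p. \<forall>p'\<in>P - {p}. m \<notin> inv_cone M (LM lt p') (LM lt ` P))"

definition involutive_basis :: "'v set \<Rightarrow> ('v mono \<Rightarrow> 'v mono \<Rightarrow> bool) \<Rightarrow>
    ('v mono \<Rightarrow> 'v mono set \<Rightarrow> 'v set) \<Rightarrow> ('v, 'a::field) mpoly set \<Rightarrow> bool" where
  "involutive_basis V lt M P \<longleftrightarrow>
     autoreduced V lt M P \<and>
     (\<forall>p\<in>P. \<forall>t\<in>monomials V. \<forall>c. inv_reduces_to_zero M lt P (p * Poly_Mapping.single t c))"

end

theory Submission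
  imports Defs
begin

text \<open>
  Let the involutive span of \<open>P\<close> be the set of all sums of \<open>q\<^sub>p * p\<close> over \<open>p \<in> P\<close>, where \<open>q\<^sub>p\<close>
  involves only multiplicative variables of \<open>p\<close>. A reduction step does not change the class of the
  current polynomial plus the remainder modulo the span, so whatever reduces to zero lies in the
  span. Conversely, if the involutive cones of the leading monomials are pairwise disjoint, as they
  are for an autoreduced set, then the leading monomials of the terms \<open>c s p\<close> of such a sum are
  pairwise distinct, and reduction strips off these terms one by one. Dehomogenisation is a ring
  homomorphism, and extendibility of the division identifies the multiplicative variables, so it
  maps the span of \<open>G'\<close> into the span of \<open>d(G')\<close>.
\<close>

subsection \<open>Leading monomials\<close>

lemma monomials_mono: "V \<subseteq> W \<Longrightarrow> monomials V \<subseteq> monomials W"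
  by (auto simp: monomials_def)

lemma zero_in_monomials: "0 \<in> monomials V"
  by (simp add: monomials_def)

lemma add_in_monomials: "s \<in> monomials V \<Longrightarrow> t \<in> monomials V \<Longrightarrow> s + t \<in> monomials V"
  using keys_add[of s t] by (fastforce simp: monomials_def)

lemma zero_in_polys: "0 \<in> polys V"
  by (simp add: polys_def)

lemma add_in_polys:
  fixes p q :: "('v, 'a::comm_monoid_add) mpoly"
  shows "p \<in> polys V \<Longrightarrow> q \<in> polys V \<Longrightarrow> p + q \<in> polys V"
  using keys_add[of p q] by (fastforce simp: polys_def)

lemma sum_in_polys:
  fixes f :: "'b \<Rightarrow> ('v, 'a::comm_monoid_add) mpoly"
  shows "(\<And>i. i \<in> A \<Longrightarrow> f i \<in> polys V) \<Longrightarrow> sum f A \<in> polys V"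
  by (induction A rule: infinite_finite_induct) (auto simp: zero_in_polys add_in_polys)

lemma single_in_polys: "s \<in> monomials V \<Longrightarrow> Poly_Mapping.single s c \<in> polys V"
  by (auto simp: polys_def)

lemma poly_eq_sum_single:
  fixes p :: "'b \<Rightarrow>\<^sub>0 'a::comm_monoid_add"
  shows "(\<Sum>m\<in>Poly_Mapping.keys p. Poly_Mapping.single m (Poly_Mapping.lookup p m)) = p"
proof (rule poly_mapping_eqI)
  fix k
  show "Poly_Mapping.lookup
      (\<Sum>m\<in>Poly_Mapping.keys p. Poly_Mapping.single m (Poly_Mapping.lookup p m)) k
    = Poly_Mapping.lookup p k"
    by (simp add: lookup_sum lookup_single when_def in_keys_iff)
qed

text \<open>Translation by \<open>s\<close> is injective on exponent vectors, so only one term of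
  \<open>g\<close> can contribute.\<close>

lemma lookup_single_times:
  fixes g :: "('v, 'a::comm_semiring_1) mpoly"
  shows "Poly_Mapping.lookup (Poly_Mapping.single s c * g) (s + m) = c * Poly_Mapping.lookup g m"
proof -
  have "Poly_Mapping.single s c * g
      = (\<Sum>k\<in>Poly_Mapping.keys g. Poly_Mapping.single (s + k) (c * Poly_Mapping.lookup g k))"
    by (subst (1) poly_eq_sum_single[of g, symmetric]) (simp add: sum_distrib_left mult_single)
  then show ?thesis
    by (simp add: lookup_sum lookup_single when_def in_keys_iff)
qed

lemma keys_single_times:
  fixes g :: "('v, 'a::comm_semiring_1) mpoly"
  shows "Poly_Mapping.keys (Poly_Mapping.single s c * g) \<subseteq> (+) s ` Poly_Mapping.keys g"
  using keys_mult[of "Poly_Mapping.single s c" g] by (auto split: if_splits)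

lemma single_times_in_polys:
  fixes g :: "('v, 'a::comm_semiring_1) mpoly"
  assumes "s \<in> monomials V" "g \<in> polys V"
  shows "Poly_Mapping.single s c * g \<in> polys V"
  using keys_single_times[of s c g] assms add_in_monomials unfolding polys_def by blast

section \<open>Leading monomials under an admissible ordering\<close>

lemma admissible_order_subset:
  assumes "admissible_order W lt" "V \<subseteq> W"
  shows "admissible_order V lt"
proof -
  have "m \<in> monomials W" if "m \<in> monomials V" for m
    using that monomials_mono[OF assms(2)] by blast
  then show ?thesis
    using assms(1) monomials_mono[OF assms(2)] unfolding admissible_order_def
    by (auto intro: irreflp_on_subset transp_on_subset totalp_on_subset)
qed

lemma LM_eqI:
  assumes ord: "admissible_order V lt" and p: "p \<in> polys V"
    and m: "m \<in> Poly_Mapping.keys p" "\<And>k. k \<in> Poly_Mapping.keys p \<Longrightarrow> k \<noteq> m \<Longrightarrow> lt k m"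
  shows "LM lt p = m"
  unfolding LM_def
proof (rule the_equality)
  fix k assume k: "k \<in> Poly_Mapping.keys p \<and> (\<forall>m'\<in>Poly_Mapping.keys p. m' \<noteq> k \<longrightarrow> lt m' k)"
  have "k \<in> monomials V" "m \<in> monomials V"
    using k m(1) p by (auto simp: polys_def)
  \<comment> \<open>\<open>LM\<close> is a definite description, so a second maximum
    \<open>k\<close> must be excluded: each maximum would lie below the other, against transitivity
    and irreflexivity.\<close>
  then have "\<not> (lt k m \<and> lt m k)"
    using ord unfolding admissible_order_def by (meson irreflp_onD transp_onD)
  then show "k = m"
    using k m by metis
qed (use m in simp)

lemma LM_props:
  assumes ord: "admissible_order V lt" and p: "p \<in> polys V" "p \<noteq> 0"
  shows LM_in_keys: "LM lt p \<in> Poly_Mapping.keys p"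
    and lt_LM: "k \<in> Poly_Mapping.keys p \<Longrightarrow> k \<noteq> LM lt p \<Longrightarrow> lt k (LM lt p)"
proof -
  have sub: "Poly_Mapping.keys p \<subseteq> monomials V"
    using p by (simp add: polys_def)
  have "\<exists>m\<in>Poly_Mapping.keys p. \<forall>k\<in>Poly_Mapping.keys p. k \<noteq> m \<longrightarrow> lt k m"
    by (rule Finite_Set.bex_greatest_element)
      (use ord sub p in \<open>auto simp: admissible_order_def
        intro: transp_on_subset totalp_on_subset\<close>)
  then obtain m where m: "m \<in> Poly_Mapping.keys p"
      "\<And>k. k \<in> Poly_Mapping.keys p \<Longrightarrow> k \<noteq> m \<Longrightarrow> lt k m"
    by blast
  have LM: "LM lt p = m"
    using LM_eqI[OF ord p(1) m] .
  show "LM lt p \<in> Poly_Mapping.keys p"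
    unfolding LM by (fact m(1))
  show "lt k (LM lt p)" if "k \<in> Poly_Mapping.keys p" "k \<noteq> LM lt p"
    using that unfolding LM by (rule m(2))
qed

lemma LM_in_monomials:
  assumes "admissible_order V lt" "p \<in> polys V" "p \<noteq> 0"
  shows "LM lt p \<in> monomials V"
  using LM_in_keys[OF assms] assms(2) by (auto simp: polys_def)

lemma LC_nonzero:
  assumes "admissible_order V lt" "p \<in> polys V" "p \<noteq> 0"
  shows "LC lt p \<noteq> 0"
  using LM_in_keys[OF assms] by (simp add: LC_def in_keys_iff)

text \<open>No cancellation occurs: translation by \<open>s\<close> is strictly monotone, so it
  keeps the order of the terms of \<open>g\<close>, and a field has no zero divisors, so the leading
  coefficient survives.\<close>

lemma
  fixes g :: "('v, 'a::field) mpoly"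
  assumes ord: "admissible_order V lt" and g: "g \<in> polys V" "g \<noteq> 0"
    and s: "s \<in> monomials V" and c: "c \<noteq> 0"
  shows LM_single_times: "LM lt (Poly_Mapping.single s c * g) = LM lt g + s"
    and LC_single_times: "LC lt (Poly_Mapping.single s c * g) = c * LC lt g"
    and single_times_nonzero: "Poly_Mapping.single s c * g \<noteq> 0"
proof -
  let ?h = "Poly_Mapping.single s c * g"
  have coeff: "Poly_Mapping.lookup ?h (LM lt g + s) = c * LC lt g"
    using lookup_single_times[of s c g "LM lt g"] by (simp add: LC_def add.commute)
  have key: "LM lt g + s \<in> Poly_Mapping.keys ?h"
    using coeff c LC_nonzero[OF ord g] by (simp add: in_keys_iff)
  then show "?h \<noteq> 0"
    by auto
  show LM: "LM lt ?h = LM lt g + s"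
  proof (rule LM_eqI[OF ord single_times_in_polys[OF s g(1)] key])
    fix k assume "k \<in> Poly_Mapping.keys ?h" "k \<noteq> LM lt g + s"
    then obtain m where m: "m \<in> Poly_Mapping.keys g" "k = m + s" "m \<noteq> LM lt g"
      using keys_single_times[of s c g] by (force simp: add.commute)
    then have "lt m (LM lt g)" "m \<in> monomials V"
      using lt_LM[OF ord g] g(1) by (auto simp: polys_def)
    then show "lt k (LM lt g + s)"
      using ord s LM_in_monomials[OF ord g] m(2) unfolding admissible_order_def by blast
  qed
  show "LC lt ?h = c * LC lt g"
    using coeff by (simp add: LC_def LM)
qed

text \<open>The greatest of the pairwise distinct leading monomials occurs in one summand only, so
  nothing can cancel it.\<close>

lemma LM_sum_distinct:
  fixes h :: "'b \<Rightarrow> ('v, 'a::comm_monoid_add) mpoly"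
  assumes ord: "admissible_order V lt" and A: "finite A" "A \<noteq> {}"
    and h: "\<And>a. a \<in> A \<Longrightarrow> h a \<in> polys V" "\<And>a. a \<in> A \<Longrightarrow> h a \<noteq> 0"
    and inj: "inj_on (\<lambda>a. LM lt (h a)) A"
  obtains a where "a \<in> A" "LM lt (sum h A) = LM lt (h a)" "LC lt (sum h A) = LC lt (h a)"
    "sum h A \<noteq> 0"
proof -
  let ?L = "\<lambda>a. LM lt (h a)"
  have sub: "?L ` A \<subseteq> monomials V"
    using LM_in_monomials[OF ord h] by blast
  have "\<exists>m\<in>?L ` A. \<forall>k\<in>?L ` A. k \<noteq> m \<longrightarrow> lt k m"
    by (rule Finite_Set.bex_greatest_element)
      (use ord sub A in \<open>auto simp: admissible_order_def
        intro: transp_on_subset totalp_on_subset\<close>)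
  then obtain a where a: "a \<in> A" "\<And>b. b \<in> A \<Longrightarrow> ?L b \<noteq> ?L a \<Longrightarrow> lt (?L b) (?L a)"
    by blast
  have below: "lt k (?L a)" if "b \<in> A" "k \<in> Poly_Mapping.keys (h b)" "b \<noteq> a \<or> k \<noteq> ?L a" for b k
  proof (cases "b = a")
    case True
    then show ?thesis
      using that lt_LM[OF ord h[OF a(1)]] by auto
  next
    case False
    then have *: "lt (?L b) (?L a)"
      using a that(1) inj by (meson inj_onD)
    have "k = ?L b \<or> lt k (?L b)"
      using lt_LM[OF ord h[OF that(1)] that(2)] by blast
    moreover have "k \<in> monomials V" "?L b \<in> monomials V" "?L a \<in> monomials V"
      using that h(1)[OF that(1)] sub a(1) by (auto simp: polys_def)
    ultimately show ?thesis
      using * ord unfolding admissible_order_def by (metis transp_onD)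
  qed
  \<comment> \<open>Irreflexivity turns \<open>below\<close> into the absence of \<open>?L a\<close>
    from every other summand.\<close>
  have "\<not> lt (?L a) (?L a)"
    using ord sub a(1) unfolding admissible_order_def by (meson image_subset_iff irreflp_onD)
  then have "Poly_Mapping.lookup (h b) (?L a) = 0" if "b \<in> A - {a}" for b
    using below[of b "?L a"] that by (auto simp: in_keys_iff)
  then have "(\<Sum>b\<in>A - {a}. Poly_Mapping.lookup (h b) (?L a)) = 0"
    by (intro sum.neutral) blast
  then have coeff: "Poly_Mapping.lookup (sum h A) (?L a) = LC lt (h a)"
    unfolding lookup_sum LC_def by (subst sum.remove[OF A(1) a(1)]) simp
  then have key: "?L a \<in> Poly_Mapping.keys (sum h A)"
    using LC_nonzero[OF ord h[OF a(1)]] by (simp add: in_keys_iff)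
  have LM: "LM lt (sum h A) = ?L a"
  proof (rule LM_eqI[OF ord sum_in_polys[OF h(1)] key])
    fix k assume k: "k \<in> Poly_Mapping.keys (sum h A)" "k \<noteq> ?L a"
    then have "(\<Sum>b\<in>A. Poly_Mapping.lookup (h b) k) \<noteq> 0"
      by (simp add: in_keys_iff lookup_sum)
    then obtain b where "b \<in> A" "Poly_Mapping.lookup (h b) k \<noteq> 0"
      by (meson sum.not_neutral_contains_not_neutral)
    then show "lt k (?L a)"
      using below k(2) by (auto simp: in_keys_iff)
  qed
  show thesis
  proof (rule that[OF a(1) LM])
    show "LC lt (sum h A) = LC lt (h a)"
      using coeff by (simp add: LC_def LM)
    show "sum h A \<noteq> 0"
      using key by auto
  qed
qed

subsection \<open>The involutive span\<close>

text \<open>The cofactors \<open>q p\<close> are whole polynomials, so a ring homomorphism can be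
  applied to them directly; they are split into terms only when a reduction is constructed.\<close>

definition inv_span :: "('v mono \<Rightarrow> 'v mono set \<Rightarrow> 'v set) \<Rightarrow> ('v mono \<Rightarrow> 'v mono \<Rightarrow> bool) \<Rightarrow>
    ('v, 'a::field) mpoly set \<Rightarrow> ('v, 'a) mpoly set" where
  "inv_span M lt P = {\<Sum>p\<in>P. q p * p |q. \<forall>p\<in>P. q p \<in> polys (mult_vars M lt p P)}"

lemma zero_in_inv_span: "0 \<in> inv_span M lt P"
  unfolding inv_span_def by (rule CollectI, rule exI[of _ "\<lambda>_. 0"]) (simp add: zero_in_polys)

lemma add_in_inv_span:
  assumes "f \<in> inv_span M lt P" "g \<in> inv_span M lt P"
  shows "f + g \<in> inv_span M lt P"
proof -
  obtain q r where "f = (\<Sum>p\<in>P. q p * p)" "\<forall>p\<in>P. q p \<in> polys (mult_vars M lt p P)"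
    "g = (\<Sum>p\<in>P. r p * p)" "\<forall>p\<in>P. r p \<in> polys (mult_vars M lt p P)"
    using assms unfolding inv_span_def by blast
  then show ?thesis
    unfolding inv_span_def
    by (intro CollectI exI[of _ "\<lambda>p. q p + r p"])
      (auto simp: sum.distrib distrib_right add_in_polys)
qed

lemma sum_in_inv_span:
  "(\<And>i. i \<in> A \<Longrightarrow> f i \<in> inv_span M lt P) \<Longrightarrow> sum f A \<in> inv_span M lt P"
  by (induction A rule: infinite_finite_induct) (auto simp: zero_in_inv_span add_in_inv_span)

lemma times_in_inv_span:
  assumes "finite P" "p \<in> P" "r \<in> polys (mult_vars M lt p P)"
  shows "r * p \<in> inv_span M lt P"
proof -
  have "r * p = (\<Sum>p'\<in>P. (if p' = p then r else 0) * p')"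
    using assms by (subst sum.remove[of _ p]) auto
  then show ?thesis
    unfolding inv_span_def using assms(3)
    by (intro CollectI exI[of _ "\<lambda>p'. if p' = p then r else 0"]) (auto simp: zero_in_polys)
qed

text \<open>Current polynomial plus remainder is the quantity to follow: a reduction subtracts an
  element of \<open>P\<close> times a term in its multiplicative variables, and a move to the
  remainder leaves the sum fixed.\<close>

lemma inv_red_step_in_inv_span:
  assumes "inv_red_step M lt P x z" "finite P"
  shows "(fst x + snd x) - (fst z + snd z) \<in> inv_span M lt P"
  using assms(1)
proof cases
  case (reduce f p r)
  \<comment> \<open>Cone membership makes the truncated difference \<open>LM lt f - LM lt p\<close>
    exact and equal to the multiplicative monomial \<open>v\<close>.\<close>
  then obtain v where v: "LM lt f = LM lt p + v" "v \<in> monomials (mult_vars M lt p P)"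
    by (auto simp: inv_cone_def mult_vars_def)
  then have "Poly_Mapping.single (LM lt f - LM lt p) (LC lt f * inverse (LC lt p)) * p
      \<in> inv_span M lt P"
    by (intro times_in_inv_span assms(2) \<open>p \<in> P\<close> single_in_polys) simp
  then show ?thesis
    using reduce by simp
next
  case (remainder f r)
  then show ?thesis
    by (simp add: zero_in_inv_span)
qed

lemma inv_reduces_to_zero_imp_in_inv_span:
  assumes "inv_reduces_to_zero M lt P f" "finite P"
  shows "f \<in> inv_span M lt P"
proof -
  \<comment> \<open>Arbitrary pairs of states are needed for the induction, since intermediate
    remainders may be nonzero.\<close>
  have "(fst x + snd x) - (fst z + snd z) \<in> inv_span M lt P"
    if "(inv_red_step M lt P)\<^sup>*\<^sup>* x z" for x z
    using that
  proof (induction rule: rtranclp_induct)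
    case base
    then show ?case
      by (simp add: zero_in_inv_span)
  next
    case (step z w)
    then show ?case
      using add_in_inv_span[OF step.IH inv_red_step_in_inv_span[OF step.hyps(2) assms(2)]]
      by (simp add: algebra_simps)
  qed
  from this[of "(f, 0)" "(0, 0)"] show ?thesis
    using assms(1) by (simp add: inv_reduces_to_zero_def)
qed

text \<open>A pair \<open>(p, s)\<close> in \<open>A\<close> stands for \<open>p\<close> times the
  term with monomial \<open>s\<close> and coefficient \<open>c (p, s)\<close>. By \<open>inj\<close>
  the leading monomials of these summands differ, so that of the sum comes from a single summand,
  and one reduction by its \<open>p\<close> deletes exactly this summand.\<close>

lemma inv_reduces_to_zero_sum:
  fixes P :: "('v, 'a::field) mpoly set"
  assumes ord: "admissible_order V lt" and P: "P \<subseteq> polys V" "0 \<notin> P"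
    and mv: "\<And>p. p \<in> P \<Longrightarrow> mult_vars M lt p P \<subseteq> V"
    and inj: "inj_on (\<lambda>(p, s). LM lt p + s) (SIGMA p:P. monomials (mult_vars M lt p P))"
    and A: "finite A" "A \<subseteq> (SIGMA p:P. monomials (mult_vars M lt p P))"
    and c: "\<And>a. a \<in> A \<Longrightarrow> c a \<noteq> 0"
  shows "inv_reduces_to_zero M lt P (\<Sum>a\<in>A. Poly_Mapping.single (snd a) (c a) * fst a)"
  using A(1)
proof (induction A rule: finite_remove_induct)
  case empty
  show ?case
    by (simp add: inv_reduces_to_zero_def)
next
  \<comment> \<open>Removal induction leaves the choice of the deleted pair to the ordering: the
    hypothesis is available for every \<open>a\<close> in \<open>B\<close>.\<close>
  case (remove B)
  let ?h = "\<lambda>a. Poly_Mapping.single (snd a) (c a) * fst a"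
  have B: "fst a \<in> P" "fst a \<in> polys V" "fst a \<noteq> 0" "c a \<noteq> 0"
      "snd a \<in> monomials (mult_vars M lt (fst a) P)" "snd a \<in> monomials V" if "a \<in> B" for a
  proof -
    have "a \<in> A"
      using that remove.hyps(3) by blast
    then have "a \<in> (SIGMA p:P. monomials (mult_vars M lt p P))" and "c a \<noteq> 0"
      using A(2) c by blast+
    then have a: "fst a \<in> P" "snd a \<in> monomials (mult_vars M lt (fst a) P)"
      by auto
    show "fst a \<in> P" "fst a \<in> polys V" "fst a \<noteq> 0" "c a \<noteq> 0"
        "snd a \<in> monomials (mult_vars M lt (fst a) P)" "snd a \<in> monomials V"
      using a P \<open>c a \<noteq> 0\<close> monomials_mono[OF mv[OF a(1)]] by auto
  qed
  have LM: "LM lt (?h a) = LM lt (fst a) + snd a" "LC lt (?h a) = c a * LC lt (fst a)"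
      "?h a \<noteq> 0" "?h a \<in> polys V" if "a \<in> B" for a
    using LM_single_times[OF ord B(2,3,6,4)] LC_single_times[OF ord B(2,3,6,4)]
      single_times_nonzero[OF ord B(2,3,6,4)] single_times_in_polys[OF B(6,2)] that by simp_all
  have "inj_on (\<lambda>a. LM lt (?h a)) B"
    using inj_on_subset[OF inj subset_trans[OF remove.hyps(3) A(2)]] LM(1)
    by (simp add: inj_on_def split_def)
  then obtain a where a: "a \<in> B" "LM lt (sum ?h B) = LM lt (?h a)"
      "LC lt (sum ?h B) = LC lt (?h a)" "sum ?h B \<noteq> 0"
    using LM_sum_distinct[OF ord remove.hyps(1,2), of ?h] LM(3,4) by blast
  note Ba = B[OF a(1)]
  have "LM lt (sum ?h B) \<in> inv_cone M (LM lt (fst a)) (LM lt ` P)"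
    using Ba(5) a(2) LM(1)[OF a(1)] by (auto simp: inv_cone_def mult_vars_def)
  \<comment> \<open>As \<open>LM lt (sum ?h B)\<close> is \<open>LM lt (fst a) + snd a\<close> and
    its coefficient is \<open>c a * LC lt (fst a)\<close>, the quotient term has monomial
    \<open>snd a\<close> and coefficient \<open>c a\<close>; the remainder stays
    \<open>0\<close>.\<close>
  from inv_red_step.reduce[OF a(4) Ba(1) this, of 0]
  have "inv_red_step M lt P (sum ?h B, 0) (sum ?h B - ?h a, 0)"
    using LC_nonzero[OF ord Ba(2,3)] a(2,3) LM(1,2)[OF a(1)] by (simp add: mult.assoc)
  moreover have "sum ?h B - ?h a = sum ?h (B - {a})"
    by (simp add: sum.remove[OF remove.hyps(1) a(1)])
  ultimately show ?case
    using remove.IH[OF a(1)] unfolding inv_reduces_to_zero_def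
    by (metis (no_types, lifting) converse_rtranclp_into_rtranclp)
qed

lemma in_inv_span_imp_inv_reduces_to_zero:
  fixes P :: "('v, 'a::field) mpoly set"
  assumes ord: "admissible_order V lt" and P: "finite P" "P \<subseteq> polys V" "0 \<notin> P"
    and mv: "\<And>p. p \<in> P \<Longrightarrow> mult_vars M lt p P \<subseteq> V"
    and inj: "inj_on (\<lambda>(p, s). LM lt p + s) (SIGMA p:P. monomials (mult_vars M lt p P))"
    and f: "f \<in> inv_span M lt P"
  shows "inv_reduces_to_zero M lt P f"
proof -
  obtain q where q: "f = (\<Sum>p\<in>P. q p * p)" "\<And>p. p \<in> P \<Longrightarrow> q p \<in> polys (mult_vars M lt p P)"
    using f unfolding inv_span_def by blast
  \<comment> \<open>One pair per term of a cofactor; taking only the keys of \<open>q p\<close>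
    makes every coefficient nonzero.\<close>
  let ?A = "SIGMA p:P. Poly_Mapping.keys (q p)"
  let ?c = "\<lambda>a. Poly_Mapping.lookup (q (fst a)) (snd a)"
  have "q p * p = (\<Sum>s\<in>Poly_Mapping.keys (q p).
      Poly_Mapping.single s (Poly_Mapping.lookup (q p) s) * p)" for p
    by (simp add: sum_distrib_right[symmetric] poly_eq_sum_single)
  then have "f = (\<Sum>a\<in>?A. Poly_Mapping.single (snd a) (?c a) * fst a)"
    using P(1) by (simp add: q(1) sum.Sigma split_def)
  moreover have "inv_reduces_to_zero M lt P
      (\<Sum>a\<in>?A. Poly_Mapping.single (snd a) (?c a) * fst a)"
    by (rule inv_reduces_to_zero_sum[OF ord P(2,3) mv inj])
      (use q(2) P(1) in \<open>auto simp: polys_def in_keys_iff\<close>)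
  ultimately show ?thesis
    by simp
qed

text \<open>A common element of two cones forces them to be nested, so one leading monomial lies in
  the cone of the other, which autoreduction forbids for distinct elements. Within a single cone,
  cancellation determines \<open>s\<close>.\<close>

lemma autoreduced_inj_on_products:
  assumes ord: "admissible_order V lt" and div: "involutive_division V M"
    and red: "autoreduced V lt M P"
  shows "inj_on (\<lambda>(p, s). LM lt p + s) (SIGMA p:P. monomials (mult_vars M lt p P))"
proof -
  have P: "finite P" "P \<subseteq> polys V" "0 \<notin> P"
    using red by (auto simp: autoreduced_def)
  let ?U = "LM lt ` P"
  let ?C = "\<lambda>p. inv_cone M (LM lt p) ?U"
  have LM: "LM lt p \<in> Poly_Mapping.keys p" "LM lt p \<in> monomials V" if "p \<in> P" for p
    using that P LM_in_keys[OF ord] LM_in_monomials[OF ord] by (metis subsetD)+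
  then have U: "finite ?U" "?U \<subseteq> monomials V"
    using P(1) by auto
  \<comment> \<open>The cofactor 1, that is the exponent vector \<open>0\<close>, is always
    multiplicative.\<close>
  have self: "LM lt p \<in> ?C p" if "p \<in> P" for p
    unfolding inv_cone_def using zero_in_monomials by force
  have disj: "p = p'" if "p \<in> P" "p' \<in> P" "w \<in> ?C p" "w \<in> ?C p'" for p p' w
  proof (rule ccontr)
    assume "p \<noteq> p'"
    then have "LM lt p \<notin> ?C p'" "LM lt p' \<notin> ?C p"
      using red LM(1) that by (auto simp: autoreduced_def)
    moreover have "?C p \<subseteq> ?C p' \<or> ?C p' \<subseteq> ?C p"
      using div U that unfolding involutive_division_def by blast
    ultimately show False
      using self that by blast
  qed
  have cone: "LM lt p + s \<in> ?C p" if "s \<in> monomials (mult_vars M lt p P)" for p s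
    using that by (auto simp: inv_cone_def mult_vars_def)
  show ?thesis
  proof (rule inj_onI, clarify)
    fix p s p' s'
    assume "p \<in> P" "p' \<in> P" "s \<in> monomials (mult_vars M lt p P)"
      "s' \<in> monomials (mult_vars M lt p' P)" and eq: "LM lt p + s = LM lt p' + s'"
    then have "p = p'"
      using disj[of p p' "LM lt p + s"] cone[of s p] cone[of s' p'] by simp
    with eq show "p = p' \<and> s = s'"
      by simp
  qed
qed

text \<open>Keeps all cofactors in the ring over \<open>V\<close>, where \<open>lt\<close> is known
  to be an admissible ordering.\<close>

lemma autoreduced_mult_vars_subset:
  assumes ord: "admissible_order V lt" and div: "involutive_division V M"
    and red: "autoreduced V lt M P" and p: "p \<in> P"
  shows "mult_vars M lt p P \<subseteq> V"
proof -
  have P: "finite P" "P \<subseteq> polys V" "0 \<notin> P"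
    using red by (auto simp: autoreduced_def)
  have "LM lt p' \<in> monomials V" if "p' \<in> P" for p'
    using that P LM_in_monomials[OF ord] by (metis subsetD)
  then have "finite (LM lt ` P)" "LM lt ` P \<subseteq> monomials V"
    using P(1) by auto
  then have "\<forall>u\<in>LM lt ` P. M u (LM lt ` P) \<subseteq> V"
    using div unfolding involutive_division_def by presburger
  then show ?thesis
    using p by (simp add: mult_vars_def)
qed

subsection \<open>Dehomogenisation\<close>

lemma update_zero_add:
  fixes s t :: "'v mono"
  shows "Poly_Mapping.update y 0 (s + t) = Poly_Mapping.update y 0 s + Poly_Mapping.update y 0 t"
  by (rule poly_mapping_eqI) (simp add: lookup_update lookup_add)

text \<open>A common index set lets polynomials with different supports be added term by
  term.\<close>

lemma dehomogenise_eq_sum: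
  assumes "finite S" "Poly_Mapping.keys p \<subseteq> S"
  shows "dehomogenise y p
    = (\<Sum>m\<in>S. Poly_Mapping.single (Poly_Mapping.update y 0 m) (Poly_Mapping.lookup p m))"
  unfolding dehomogenise_def
  by (rule sum.mono_neutral_left) (use assms in \<open>auto simp: in_keys_iff\<close>)

lemma dehomogenise_zero: "dehomogenise y 0 = 0"
  by (simp add: dehomogenise_def)

lemma dehomogenise_single:
  "dehomogenise y (Poly_Mapping.single s c) = Poly_Mapping.single (Poly_Mapping.update y 0 s) c"
  by (simp add: dehomogenise_def)

lemma dehomogenise_add: "dehomogenise y (p + q) = dehomogenise y p + dehomogenise y q"
proof -
  let ?S = "Poly_Mapping.keys p \<union> Poly_Mapping.keys q"
  show ?thesis
    using keys_add[of p q]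
    by (simp add: dehomogenise_eq_sum[of ?S] lookup_add single_add sum.distrib)
qed

lemma dehomogenise_sum: "dehomogenise y (sum f A) = (\<Sum>i\<in>A. dehomogenise y (f i))"
  by (induction A rule: infinite_finite_induct)
    (auto simp: dehomogenise_zero dehomogenise_add)

text \<open>By bilinearity it suffices to treat products of terms, where erasing the exponent of
  \<open>y\<close> is additive.\<close>

lemma dehomogenise_mult:
  fixes p q :: "('v, 'a::comm_semiring_1) mpoly"
  shows "dehomogenise y (p * q) = dehomogenise y p * dehomogenise y q"
proof -
  let ?t = "\<lambda>p m. Poly_Mapping.single m (Poly_Mapping.lookup p m)"
  have "p * q = (\<Sum>m\<in>Poly_Mapping.keys p. ?t p m) * (\<Sum>k\<in>Poly_Mapping.keys q. ?t q k)"
    by (simp add: poly_eq_sum_single)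
  also have "dehomogenise y \<dots> = dehomogenise y p * dehomogenise y q"
    by (simp add: sum_product mult_single dehomogenise_sum dehomogenise_single update_zero_add
        dehomogenise_def[of y p] dehomogenise_def[of y q])
  finally show ?thesis .
qed

lemma dehomogenise_in_polys:
  assumes "p \<in> polys V"
  shows "dehomogenise y p \<in> polys (V - {y})"
  unfolding dehomogenise_def
  by (intro sum_in_polys single_in_polys)
    (use assms in \<open>auto simp: polys_def monomials_def keys_update\<close>)

text \<open>Dehomogenising a cofactor removes \<open>y\<close>, and by \<open>mv\<close> what
  remains is multiplicative for the dehomogenised element. Different \<open>p\<close> may have the
  same image; closure of the span under sums absorbs this.\<close>

lemma dehomogenise_in_inv_span:
  fixes P :: "('v, 'a::field) mpoly set"
  assumes fin: "finite P"
    and mv: "\<And>p. p \<in> P \<Longrightarrow> mult_vars M lt p P - {y}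
      = mult_vars N lt (dehomogenise y p) (dehomogenise y ` P)"
    and f: "f \<in> inv_span M lt P"
  shows "dehomogenise y f \<in> inv_span N lt (dehomogenise y ` P)"
proof -
  let ?d = "dehomogenise y"
  obtain q where q: "f = (\<Sum>p\<in>P. q p * p)" "\<And>p. p \<in> P \<Longrightarrow> q p \<in> polys (mult_vars M lt p P)"
    using f unfolding inv_span_def by blast
  have "?d (q p) * ?d p \<in> inv_span N lt (?d ` P)" if "p \<in> P" for p
    using times_in_inv_span[of "?d ` P" "?d p" "?d (q p)" N lt] fin that mv[OF that]
      dehomogenise_in_polys[OF q(2)[OF that], of y] by simp
  then show ?thesis
    by (simp add: q(1) dehomogenise_sum dehomogenise_mult sum_in_inv_span)
qed

theorem proposition4p5p9:
  fixes X :: "'v set" and y :: 'v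
    and lt :: "'v mono \<Rightarrow> 'v mono \<Rightarrow> bool"
    and I :: "'v set \<Rightarrow> 'v mono \<Rightarrow> 'v mono set \<Rightarrow> 'v set"
    and K G' :: "('v, 'a::field) mpoly set"
  assumes "finite X" and "y \<notin> X"
    and "admissible_order (insert y X) lt"
    and "extendible_order TYPE('a) X y lt"
    and "involutive_division (insert y X) (I (insert y X))"
    and "involutive_division X (I X)"
    and "K \<in> {polys (insert y X), homogeneous_polys (insert y X)}"
    and "extendible_division K X y lt I"
    and "G' \<subseteq> K"
    and "involutive_basis (insert y X) lt (I (insert y X)) G'"
    and "autoreduced X lt (I X) (dehomogenise y ` G')"
  shows "involutive_basis X lt (I X) (dehomogenise y ` G')"
proof -
  let ?d = "dehomogenise y"
  have ord: "admissible_order X lt"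
    using assms(3) by (rule admissible_order_subset) auto
  have fin: "finite G'"
    using assms(10) by (simp add: involutive_basis_def autoreduced_def)
  have dG: "finite (?d ` G')" "?d ` G' \<subseteq> polys X" "0 \<notin> ?d ` G'"
    using assms(11) by (auto simp: autoreduced_def)
  \<comment> \<open>Extendibility applies to \<open>G'\<close> itself, since it is finite, lies in
    \<open>K\<close>, and autoreduction of the image excludes \<open>0\<close>.\<close>
  have mv: "mult_vars (I (insert y X)) lt g G' - {y} = mult_vars (I X) lt (?d g) (?d ` G')"
    if "g \<in> G'" for g
    using assms(8,9) fin dG(3) that unfolding extendible_division_def by blast
  have "inv_reduces_to_zero (I X) lt (?d ` G') (?d g * Poly_Mapping.single t c)"
    if "g \<in> G'" "t \<in> monomials X" for g t c
  proof -
    have "t \<in> monomials (insert y X)"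
      using that(2) monomials_mono[of X "insert y X"] by auto
    then have "inv_reduces_to_zero (I (insert y X)) lt G' (g * Poly_Mapping.single t c)"
      using assms(10) that(1) by (simp add: involutive_basis_def)
    then have "?d (g * Poly_Mapping.single t c) \<in> inv_span (I X) lt (?d ` G')"
      by (intro dehomogenise_in_inv_span[OF fin mv] inv_reduces_to_zero_imp_in_inv_span fin)
    \<comment> \<open>Since \<open>t\<close> does not contain \<open>y\<close>, dehomogenisation
      fixes it.\<close>
    moreover have "Poly_Mapping.update y 0 t = t"
      using that(2) \<open>y \<notin> X\<close>
      by (intro poly_mapping_eqI) (auto simp: lookup_update monomials_def in_keys_iff)
    ultimately have "?d g * Poly_Mapping.single t c \<in> inv_span (I X) lt (?d ` G')"
      by (simp add: dehomogenise_mult dehomogenise_single)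
    \<comment> \<open>Autoreduction of the image supplies the disjoint cones that turn span
      membership back into a reduction.\<close>
    then show ?thesis
      by (intro in_inv_span_imp_inv_reduces_to_zero[OF ord dG]
          autoreduced_inj_on_products[OF ord assms(6,11)]
          autoreduced_mult_vars_subset[OF ord assms(6,11)])
  qed
  then show ?thesis
    using assms(11) by (auto simp: involutive_basis_def)
qed

end
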